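(* Let the Fourier weights $\alpha_{\nu,j}>0$, $\nu\in\mathbb{N}_0$, $j\in\mathbb{N}$, be given according to one of the following two cases, where in both cases $\alpha_{0,j}>0$, $j\in\mathbb{N}$, is any choice with $\sum_{j\in\mathbb{N}}|\alpha_{0,j}-1|<\infty$: (PG) $r_j>1/2$ for $j\in\mathbb{N}$ with $\sum_{j\in\mathbb{N}}2^{-r_j}<\infty$, and $\alpha_{\nu,j}:=(\nu+1)^{r_j}$ for $\nu,j\in\mathbb{N}$; (EG) $r_j>0$ for $j\in\mathbb{N}$ with $\sum_{j\in\mathbb{N}}2^{-r_j}<\infty$, $b_j>0$ for $j\in\mathbb{N}$ with $\inf_{j\in\mathbb{N}}b_j>0$, and $\alpha_{\nu,j}:=2^{r_j\cdot\nu^{b_j}}$ for $\nu,j\in\mathbb{N}$. Then, in both cases, the following three properties hold: (H1) $\sum_{\nu\in\mathbb{N}}\alpha_{\nu,j}^{-1}\cdot\nu^{-1/2}<\infty$ for every $j\in\mathbb{N}$, and $\alpha_{\nu,j}\le\alpha_{\nu+1,j}$ for all $\nu,j\in\mathbb{N}$; (H2) $\sum_{j\in\mathbb{N}}|\alpha_{0,j}-1|<\infty$; (H3) there exists an integer $j_0\in\mathbb{N}$ such that $\sum_{\nu\in\mathbb{N},\,j\ge j_0}\alpha_{\nu,j}^{-1}<\infty$.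
   Context: $\mathbb{N}=\{1,2,\dots\}$ and $\mathbb{N}_0=\mathbb{N}\cup\{0\}$. *)

theory Defs
  imports "HOL-Analysis.Analysis"
begin

(* The index set {1,2,...} is written {1..} (of type nat set). In alpha nu j the index nu ranges
   over all naturals, while j ranges over {1..} only: the values at j = 0 are junk and are never
   constrained or used. A series of nonnegative terms is finite iff it is summable_on its index
   set. *)

definition PG :: "(nat \<Rightarrow> nat \<Rightarrow> real) \<Rightarrow> (nat \<Rightarrow> real) \<Rightarrow> bool" where
  "PG \<alpha> r \<longleftrightarrow>
     (\<forall>j\<in>{1..}. r j > 1 / 2) \<and>
     (\<lambda>j. 2 powr (- r j)) summable_on {1..} \<and>
     (\<forall>\<nu>\<in>{1..}. \<forall>j\<in>{1..}. \<alpha> \<nu> j = (real \<nu> + 1) powr r j)"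

(* The infimum is the conditionally complete one on the reals; it is the genuine infimum here,
   since the family is nonempty and, by positivity, bounded below. *)
definition EG :: "(nat \<Rightarrow> nat \<Rightarrow> real) \<Rightarrow> (nat \<Rightarrow> real) \<Rightarrow> (nat \<Rightarrow> real) \<Rightarrow> bool" where
  "EG \<alpha> r b \<longleftrightarrow>
     (\<forall>j\<in>{1..}. r j > 0) \<and>
     (\<lambda>j. 2 powr (- r j)) summable_on {1..} \<and>
     (\<forall>j\<in>{1..}. b j > 0) \<and>
     (INF j\<in>{1..}. b j) > 0 \<and>
     (\<forall>\<nu>\<in>{1..}. \<forall>j\<in>{1..}. \<alpha> \<nu> j = 2 powr (r j * real \<nu> powr b j))"

definition H1 :: "(nat \<Rightarrow> nat \<Rightarrow> real) \<Rightarrow> bool" where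
  "H1 \<alpha> \<longleftrightarrow>
     (\<forall>j\<in>{1..}. (\<lambda>\<nu>. inverse (\<alpha> \<nu> j) * real \<nu> powr (- 1 / 2)) summable_on {1..}) \<and>
     (\<forall>\<nu>\<in>{1..}. \<forall>j\<in>{1..}. \<alpha> \<nu> j \<le> \<alpha> (\<nu> + 1) j)"

definition H2 :: "(nat \<Rightarrow> nat \<Rightarrow> real) \<Rightarrow> bool" where
  "H2 \<alpha> \<longleftrightarrow> (\<lambda>j. \<bar>\<alpha> 0 j - 1\<bar>) summable_on {1..}"

definition H3 :: "(nat \<Rightarrow> nat \<Rightarrow> real) \<Rightarrow> bool" where
  "H3 \<alpha> \<longleftrightarrow>
     (\<exists>j0\<in>{1..}. (\<lambda>(\<nu>, j). inverse (\<alpha> \<nu> j)) summable_on ({1..} \<times> {j0..}))"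

end

theory Submission
  imports Defs "HOL-Real_Asymp.Real_Asymp"
begin

text \<open>
  (H2) is a hypothesis, and the monotonicity in (H1) is that of \<open>powr\<close>. The two summability claims
  rest on the following.

  In (H1) the index \<open>j\<close> is fixed. For polynomial weights the factor \<open>\<nu> powr (-1/2)\<close> raises the decay
  from the exponent \<open>r j > 1/2\<close> to \<open>r j + 1/2 > 1\<close>, which is just enough
  (\<open>summable_on_polynomial_weights\<close>). For exponential weights the reciprocals alone are summable, since
  \<open>2 powr (- c * \<nu> powr \<beta>)\<close> decays faster than every power of \<open>\<nu>\<close>
  (\<open>summable_on_stretched_exponential\<close>).

  In (H3) a tail of the double series is dominated by a product \<open>h \<nu> * 2 powr (- r j)\<close> of two summable
  families (\<open>H3_if_product_bound\<close>). The first reciprocal, at \<open>\<nu> = 1\<close>, is exactly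
  \<open>2 powr (- r j)\<close> in both cases, so the question is how fast the quotient of the \<open>\<nu>\<close>-th by the first
  one decays. This quotient does not increase with \<open>r j\<close>, and \<open>r j\<close> tends to infinity because
  \<open>2 powr (- r j)\<close> is summable (\<open>eventually_ge_if_summable_two_powr\<close>). Once \<open>r j\<close> reaches a suitable
  threshold, the quotient is therefore at most its value at that threshold, which yields \<open>h \<nu>\<close>. In
  the exponential case the infimum of the \<open>b j\<close> takes the place of \<open>b j\<close> to make \<open>h\<close> independent of
  \<open>j\<close>.
\<close>

lemma summable_on_atLeast_1:
  fixes f :: "nat \<Rightarrow> real"
  assumes "summable f" "\<And>n. 0 \<le> f n"
  shows "f summable_on {1..}"
  using assms summable_on_UNIV_nonneg_real_iff summable_on_subset_banach subset_UNIV by metis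

lemma summable_on_powr:
  assumes "s < -1"
  shows "(\<lambda>\<nu>. real \<nu> powr s) summable_on {1..}"
  using assms by (intro summable_on_atLeast_1) (simp_all add: summable_real_powr_iff)

lemma summable_on_stretched_exponential:
  fixes c \<beta> :: real
  assumes "c > 0" "\<beta> > 0"
  shows "(\<lambda>\<nu>. 2 powr (- (c * real \<nu> powr \<beta>))) summable_on {1..}"
proof (rule summable_on_atLeast_1)
  have "(\<lambda>\<nu>. 2 powr (- (c * real \<nu> powr \<beta>))) \<in> O(\<lambda>\<nu>. real \<nu> powr (-2))"
    using assms by real_asymp
  then show "summable (\<lambda>\<nu>. 2 powr (- (c * real \<nu> powr \<beta>)))"
    by (rule summable_comparison_test_bigo[rotated]) (simp add: summable_real_powr_iff)
qed simp

lemma summable_on_Times_product: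
  fixes f :: "'a \<Rightarrow> real" and g :: "'b \<Rightarrow> real"
  assumes "f summable_on A" "g summable_on B"
    and "\<And>x. x \<in> A \<Longrightarrow> 0 \<le> f x" "\<And>y. y \<in> B \<Longrightarrow> 0 \<le> g y"
  shows "(\<lambda>(x, y). f x * g y) summable_on (A \<times> B)"
proof (rule summable_on_SigmaI[where g = "\<lambda>x. f x * infsum g B"])
  show "((\<lambda>y. case (x, y) of (x, y) \<Rightarrow> f x * g y) has_sum f x * infsum g B) B" for x
    using assms(2) by (simp add: has_sum_cmult_right)
  show "(\<lambda>x. f x * infsum g B) summable_on A"
    using assms(1) by (rule summable_on_cmult_left)
qed (use assms in auto)

text \<open>The terms of a convergent series tend to zero, so the exponents \<open>r j\<close> tend to infinity.\<close>

lemma eventually_ge_if_summable_two_powr: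
  fixes r :: "nat \<Rightarrow> real"
  assumes "(\<lambda>j. 2 powr (- r j)) summable_on {1..}"
  shows "eventually (\<lambda>j. K \<le> r j) sequentially"
proof -
  have "range Suc = {1..}"
    by (auto simp: image_iff Suc_le_eq gr0_conv_Suc)
  then have "(\<lambda>j. 2 powr (- r (Suc j))) summable_on UNIV"
    using assms summable_on_reindex[of Suc UNIV "\<lambda>j. 2 powr (- r j)"] by (simp add: o_def)
  then have "(\<lambda>j. 2 powr (- r (Suc j))) \<longlonglongrightarrow> 0"
    by (intro summable_LIMSEQ_zero summable_on_imp_summable)
  then have "eventually (\<lambda>j. 2 powr (- r (Suc j)) < 2 powr (- K)) sequentially"
    by (rule order_tendstoD) simp
  then have "eventually (\<lambda>j. K \<le> r (Suc j)) sequentially"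
    by (rule eventually_mono) simp
  then show ?thesis
    by (rule eventually_sequentially_Suc[THEN iffD1])
qed

text \<open>
  Since \<open>r j\<close> tends to infinity, the threshold \<open>K\<close> is passed for all large \<open>j\<close>, and the product bound
  then dominates a tail of the double series.
\<close>

lemma H3_if_product_bound:
  fixes K :: real
  assumes pos: "\<And>\<nu> j. j \<ge> 1 \<Longrightarrow> \<alpha> \<nu> j > 0"
    and r: "(\<lambda>j. 2 powr (- r j)) summable_on {1..}"
    and h: "h summable_on {1..}" "\<And>\<nu>. 0 \<le> h \<nu>"
    and bound: "\<And>\<nu> j. \<lbrakk>\<nu> \<ge> 1; j \<ge> 1; K \<le> r j\<rbrakk> \<Longrightarrow> inverse (\<alpha> \<nu> j) \<le> h \<nu> * 2 powr (- r j)"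
  shows "H3 \<alpha>"
proof -
  obtain N where N: "\<And>j. j \<ge> N \<Longrightarrow> K \<le> r j"
    using eventually_ge_if_summable_two_powr[OF r] by (auto simp: eventually_sequentially)
  define j0 where "j0 = max 1 N"
  have "(\<lambda>j. 2 powr (- r j)) summable_on {j0..}"
    using r by (rule summable_on_subset_banach) (simp add: j0_def)
  then have "(\<lambda>(\<nu>, j). h \<nu> * 2 powr (- r j)) summable_on ({1..} \<times> {j0..})"
    using h by (intro summable_on_Times_product) auto
  then have "(\<lambda>(\<nu>, j). inverse (\<alpha> \<nu> j)) summable_on ({1..} \<times> {j0..})"
    by (rule summable_on_comparison_test) (use bound N pos in \<open>auto simp: j0_def less_imp_le\<close>)
  then show ?thesis
    unfolding H3_def j0_def by (intro bexI[of _ "max 1 N"]) auto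
qed

lemma summable_on_polynomial_weights:
  fixes s :: real
  assumes "s > 1 / 2"
  shows "(\<lambda>\<nu>. inverse ((real \<nu> + 1) powr s) * real \<nu> powr (- 1 / 2)) summable_on {1..}"
proof (rule summable_on_comparison_test)
  show "(\<lambda>\<nu>. real \<nu> powr (- s - 1 / 2)) summable_on {1..}"
    using assms by (intro summable_on_powr) simp
next
  fix \<nu> :: nat
  assume "\<nu> \<in> {1..}"
  then have "inverse ((real \<nu> + 1) powr s) \<le> real \<nu> powr (- s)"
    using assms by (auto simp: powr_minus intro!: le_imp_inverse_le powr_mono2)
  then have "inverse ((real \<nu> + 1) powr s) * real \<nu> powr (- 1 / 2) \<le> real \<nu> powr (- s) * real \<nu> powr (- 1 / 2)"
    by (rule mult_right_mono) simp
  also have "\<dots> = real \<nu> powr (- s - 1 / 2)"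
    by (simp flip: powr_add)
  finally show "inverse ((real \<nu> + 1) powr s) * real \<nu> powr (- 1 / 2) \<le> real \<nu> powr (- s - 1 / 2)" .
qed simp

lemma PG_imp_H1:
  assumes "PG \<alpha> r"
  shows "H1 \<alpha>"
  unfolding H1_def
proof (intro conjI ballI)
  fix j :: nat
  assume j: "j \<in> {1..}"
  with assms have r: "r j > 1 / 2" and \<alpha>: "\<And>\<nu>. \<nu> \<in> {1..} \<Longrightarrow> \<alpha> \<nu> j = (real \<nu> + 1) powr r j"
    by (auto simp: PG_def)
  show "(\<lambda>\<nu>. inverse (\<alpha> \<nu> j) * real \<nu> powr (- 1 / 2)) summable_on {1..}"
    using summable_on_polynomial_weights[OF r] by (rule summable_on_cong[THEN iffD1, rotated]) (simp add: \<alpha>)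
next
  fix \<nu> j :: nat
  assume \<nu>: "\<nu> \<in> {1..}" and j: "j \<in> {1..}"
  then have "r j > 1 / 2"
    using assms by (simp add: PG_def)
  then have "r j \<ge> 0"
    by simp
  with \<nu> j show "\<alpha> \<nu> j \<le> \<alpha> (\<nu> + 1) j"
    using assms by (auto simp: PG_def intro!: powr_mono2)
qed

text \<open>
  The quotient of the \<open>\<nu>\<close>-th by the first reciprocal is \<open>((\<nu> + 1) / 2) powr (- r j)\<close>, which is at
  most \<open>4 * \<nu> powr (-2)\<close> as soon as \<open>r j\<close> is at least \<open>2\<close>.
\<close>

lemma PG_imp_H3:
  assumes pos: "\<And>\<nu> j. j \<ge> 1 \<Longrightarrow> \<alpha> \<nu> j > 0" and PG: "PG \<alpha> r"
  shows "H3 \<alpha>"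
proof (rule H3_if_product_bound[where r = r and K = 2 and h = "\<lambda>\<nu>. 4 * real \<nu> powr (-2)", OF pos])
  show "(\<lambda>\<nu>. 4 * real \<nu> powr (-2)) summable_on {1..}"
    by (intro summable_on_cmult_right summable_on_powr) simp
next
  fix \<nu> j :: nat
  assume \<nu>: "\<nu> \<ge> 1" and j: "j \<ge> 1" and r: "2 \<le> r j"
  have "inverse (\<alpha> \<nu> j) = (real \<nu> + 1) powr (- r j)"
    using PG \<nu> j by (simp add: PG_def powr_minus)
  also have "\<dots> = ((real \<nu> + 1) / 2 * 2) powr (- r j)"
    by (rule arg_cong2[where f = "(powr)"]) (auto simp: field_simps)
  also have "\<dots> = ((real \<nu> + 1) / 2) powr (- r j) * 2 powr (- r j)"
    by (rule powr_mult)
  also have "((real \<nu> + 1) / 2) powr (- r j) \<le> ((real \<nu> + 1) / 2) powr (-2)"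
    using \<nu> r by (intro powr_mono) auto
  also have "\<dots> \<le> (real \<nu> / 2) powr (-2)"
    using \<nu> by (intro powr_mono2') auto
  also have "\<dots> = 4 * real \<nu> powr (-2)"
    using \<nu> by (simp add: powr_divide powr_minus powr_numeral field_simps)
  finally show "inverse (\<alpha> \<nu> j) \<le> 4 * real \<nu> powr (-2) * 2 powr (- r j)"
    by (simp add: mult_right_mono)
qed (use PG in \<open>auto simp: PG_def\<close>)

lemma EG_imp_H1:
  assumes "EG \<alpha> r b"
  shows "H1 \<alpha>"
  unfolding H1_def
proof (intro conjI ballI)
  fix j :: nat
  assume j: "j \<in> {1..}"
  with assms have r: "r j > 0" and b: "b j > 0"
    and \<alpha>: "\<And>\<nu>. \<nu> \<in> {1..} \<Longrightarrow> inverse (\<alpha> \<nu> j) = 2 powr (- (r j * real \<nu> powr b j))"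
    by (auto simp: EG_def powr_minus)
  show "(\<lambda>\<nu>. inverse (\<alpha> \<nu> j) * real \<nu> powr (- 1 / 2)) summable_on {1..}"
  proof (rule summable_on_comparison_test[OF summable_on_stretched_exponential[OF r b]])
    fix \<nu> :: nat
    assume \<nu>: "\<nu> \<in> {1..}"
    then have "real \<nu> powr (- 1 / 2) \<le> real \<nu> powr 0"
      by (intro powr_mono) auto
    then have "real \<nu> powr (- 1 / 2) \<le> 1"
      using \<nu> by simp
    then show "inverse (\<alpha> \<nu> j) * real \<nu> powr (- 1 / 2) \<le> 2 powr (- (r j * real \<nu> powr b j))"
      unfolding \<alpha>[OF \<nu>] by (intro mult_left_le) auto
  qed (simp add: \<alpha>)
next
  fix \<nu> j :: nat
  assume "\<nu> \<in> {1..}" "j \<in> {1..}"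
  moreover from this assms have "r j \<ge> 0" "b j \<ge> 0"
    by (auto simp: EG_def less_imp_le)
  ultimately show "\<alpha> \<nu> j \<le> \<alpha> (\<nu> + 1) j"
    using assms by (auto simp: EG_def intro!: powr_mono2)
qed

text \<open>
  With \<open>\<beta>\<close> the infimum of the \<open>b j\<close>, the quotient of the \<open>\<nu>\<close>-th by the first reciprocal is
  \<open>2 powr (- r j * (\<nu> powr b j - 1))\<close>, which is at most \<open>2 powr (1 - \<nu> powr \<beta>)\<close> as soon as \<open>r j\<close> is
  at least \<open>1\<close>.
\<close>

lemma EG_imp_H3:
  assumes pos: "\<And>\<nu> j. j \<ge> 1 \<Longrightarrow> \<alpha> \<nu> j > 0" and EG: "EG \<alpha> r b"
  shows "H3 \<alpha>"
proof -
  define \<beta> where "\<beta> = (INF j\<in>{1..}. b j)"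
  have "\<beta> > 0"
    using EG by (simp add: EG_def \<beta>_def)
  have "bdd_below (b ` {1..})"
    using EG by (intro bdd_belowI[of _ 0]) (auto simp: EG_def less_imp_le)
  then have \<beta>_le: "\<beta> \<le> b j" if "j \<ge> 1" for j
    using that unfolding \<beta>_def by (intro cINF_lower) auto
  show ?thesis
  proof (rule H3_if_product_bound
      [where r = r and K = 1 and h = "\<lambda>\<nu>. 2 * 2 powr (- (1 * real \<nu> powr \<beta>))", OF pos])
    show "(\<lambda>\<nu>. 2 * 2 powr (- (1 * real \<nu> powr \<beta>))) summable_on {1..}"
      using \<open>\<beta> > 0\<close> by (intro summable_on_cmult_right summable_on_stretched_exponential) auto
  next
    fix \<nu> j :: nat
    assume \<nu>: "\<nu> \<ge> 1" and j: "j \<ge> 1" and r: "1 \<le> r j"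
    have \<beta>_b: "real \<nu> powr \<beta> \<le> real \<nu> powr b j"
      using \<nu> \<beta>_le[OF j] by (intro powr_mono) auto
    have "1 \<le> real \<nu> powr \<beta>"
      using \<nu> \<open>\<beta> > 0\<close> by (simp add: ge_one_powr_ge_zero)
    with \<beta>_b have "1 * (real \<nu> powr b j - 1) \<le> r j * (real \<nu> powr b j - 1)"
      using r by (intro mult_right_mono) auto
    with \<beta>_b have exponent: "- (r j * real \<nu> powr b j) \<le> 1 + - (1 * real \<nu> powr \<beta>) + - r j"
      by (simp add: algebra_simps)
    have "inverse (\<alpha> \<nu> j) = 2 powr (- (r j * real \<nu> powr b j))"
      using EG \<nu> j by (simp add: EG_def powr_minus)
    also have "\<dots> \<le> 2 powr (1 + - (1 * real \<nu> powr \<beta>) + - r j)"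
      using exponent by simp
    also have "\<dots> = 2 * 2 powr (- (1 * real \<nu> powr \<beta>)) * 2 powr (- r j)"
      by (simp only: powr_add) simp
    finally show "inverse (\<alpha> \<nu> j) \<le> 2 * 2 powr (- (1 * real \<nu> powr \<beta>)) * 2 powr (- r j)" .
  qed (use EG in \<open>auto simp: EG_def\<close>)
qed

theorem lemma3p17:
  fixes \<alpha> :: "nat \<Rightarrow> nat \<Rightarrow> real" and r b :: "nat \<Rightarrow> real"
  assumes "\<forall>\<nu>. \<forall>j\<in>{1..}. \<alpha> \<nu> j > 0"
    and "(\<lambda>j. \<bar>\<alpha> 0 j - 1\<bar>) summable_on {1..}"
    and "PG \<alpha> r \<or> EG \<alpha> r b"
  shows "H1 \<alpha> \<and> H2 \<alpha> \<and> H3 \<alpha>"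
proof -
  have pos: "\<And>\<nu> j. j \<ge> 1 \<Longrightarrow> \<alpha> \<nu> j > 0"
    using assms(1) by simp
  have "H2 \<alpha>"
    using assms(2) by (simp add: H2_def)
  with assms(3) show ?thesis
    using PG_imp_H1 PG_imp_H3 EG_imp_H1 EG_imp_H3 pos by metis
qed

end
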